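(* Let $G$ be a topological group, $X$ a nonempty space and $\alpha:G\times X\to X$ a continuous $d$-open action. Then there exist a topological group $H$ and a continuous $d$-open action $\gamma:H\times X\to X$ such that $|H|\le w(X)$ and $w(H)\le w(X)$.
   Context: All spaces (including topological groups) are Tychonoff. $w(\cdot)$ denotes the weight of a space (the least cardinality of a base). A continuous action of a topological group $G$ on $X$ is $d$-open if $x\in\mathrm{int}(\mathrm{cl}(Ox))$ for every $x\in X$ and every open neighborhood $O$ of the unit $e\in G$. *)

theory Defs
  imports "HOL-Analysis.Analysis" "HOL-Algebra.Group_Action"
begin

unbundle cardinal_syntax

definition tychonoff_space :: "'a topology \<Rightarrow> bool" where
  "tychonoff_space X \<longleftrightarrow> Hausdorff_space X \<and> completely_regular_space X"

definition topology_base :: "'a topology \<Rightarrow> 'a set set \<Rightarrow> bool" where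
  "topology_base X \<B> \<longleftrightarrow>
     (\<forall>V\<in>\<B>. openin X V) \<and>
     (\<forall>U x. openin X U \<and> x \<in> U \<longrightarrow> (\<exists>V\<in>\<B>. x \<in> V \<and> V \<subseteq> U))"

text \<open>The weight is taken literally as the least cardinality of a base, so it may be finite;
  it is represented by a cardinal order, to be compared with \<open>\<le>o\<close>.\<close>

definition weight :: "'a topology \<Rightarrow> 'a set rel" where
  "weight X = (SOME r. \<exists>\<B>. topology_base X \<B> \<and> r = |\<B>| \<and>
                 (\<forall>\<C>. topology_base X \<C> \<longrightarrow> |\<B>| \<le>o |\<C>| ))"

lemma weight_attained:
  "\<exists>\<B>. topology_base X \<B> \<and> weight X = |\<B>| \<and> (\<forall>\<C>. topology_base X \<C> \<longrightarrow> |\<B>| \<le>o |\<C>| )"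
proof -
  let ?R = "card_of ` {\<B>. topology_base X \<B>}"
  have "topology_base X {U. openin X U}"
    by (auto simp: topology_base_def)
  then have "?R \<noteq> {}" by blast
  moreover have "\<forall>r\<in>?R. Card_order r" by (auto simp: card_of_Card_order)
  ultimately have "\<exists>r\<in>?R. \<forall>r'\<in>?R. r \<le>o r'"
    by (rule exists_minim_Card_order)
  then obtain \<B> where "topology_base X \<B>" and "\<forall>r'\<in>?R. |\<B>| \<le>o r'"
    by (elim bexE imageE) simp
  then have "topology_base X \<B> \<and> |\<B>| = |\<B>| \<and> (\<forall>\<C>. topology_base X \<C> \<longrightarrow> |\<B>| \<le>o |\<C>| )"
    by simp
  then have "\<exists>r \<B>. topology_base X \<B> \<and> r = |\<B>| \<and> (\<forall>\<C>. topology_base X \<C> \<longrightarrow> |\<B>| \<le>o |\<C>| )"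
    by (intro exI)
  then show ?thesis
    unfolding weight_def by (rule someI_ex)
qed

lemma weight_le_injects:
  fixes A :: "'b set" and X :: "'a topology"
  assumes "|A| \<le>o weight X"
  shows "\<exists>f :: 'b \<Rightarrow> 'a set. inj_on f A"
proof -
  obtain \<B> where "weight X = |\<B>|"
    using weight_attained[of X] by (elim exE conjE)
  with assms have "|A| \<le>o |\<B>|" by simp
  then obtain f :: "'b \<Rightarrow> 'a set" where "inj_on f A"
    unfolding card_of_ordLeq[symmetric] by auto
  then show ?thesis by auto
qed

definition topological_group :: "('g, 'm) monoid_scheme \<Rightarrow> 'g topology \<Rightarrow> bool" where
  "topological_group G T \<longleftrightarrow>
     group G \<and> topspace T = carrier G \<and> tychonoff_space T \<and>
     continuous_map (prod_topology T T) T (\<lambda>(g, h). g \<otimes>\<^bsub>G\<^esub> h) \<and>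
     continuous_map T T (\<lambda>g. inv\<^bsub>G\<^esub> g)"

text \<open>The library's \<open>group_action\<close> takes the action in curried form, each \<open>\<alpha> g\<close> being a
  bijection of the space, normalised to be \<open>undefined\<close> outside it.\<close>

definition continuous_action ::
  "('g, 'm) monoid_scheme \<Rightarrow> 'g topology \<Rightarrow> 'a topology \<Rightarrow> ('g \<Rightarrow> 'a \<Rightarrow> 'a) \<Rightarrow> bool" where
  "continuous_action G T X \<alpha> \<longleftrightarrow>
     group_action G (topspace X) \<alpha> \<and>
     continuous_map (prod_topology T X) X (\<lambda>(g, x). \<alpha> g x)"

definition d_open_action ::
  "('g, 'm) monoid_scheme \<Rightarrow> 'g topology \<Rightarrow> 'a topology \<Rightarrow> ('g \<Rightarrow> 'a \<Rightarrow> 'a) \<Rightarrow> bool" where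
  "d_open_action G T X \<alpha> \<longleftrightarrow>
     (\<forall>x\<in>topspace X. \<forall>V. openin T V \<and> \<one>\<^bsub>G\<^esub> \<in> V \<longrightarrow>
        x \<in> X interior_of (X closure_of ((\<lambda>g. \<alpha> g x) ` V)))"

text \<open>In statements asserting the existence of a group \<open>H\<close> with \<open>|carrier H| \<le>o weight X\<close>,
  where \<open>X :: 'a topology\<close>, taking the elements of \<open>H\<close> from the type \<open>'a set\<close> loses no
  generality: by \<open>weight_le_injects\<close> every such group, over whatever type, has an
  isomorphic copy there. No relation between the elements of \<open>H\<close> and subsets of \<open>X\<close> is meant.\<close>

end

theory Submission
  imports Defs
begin

text \<open>
  Let \<open>\<B>\<close> be a base of \<open>X\<close> of least cardinality, and suppose it is infinite. The group \<open>H\<close> is a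
  subgroup of \<open>G\<close>, acting as before, but with a topology coarser than the subspace topology; both
  are found by a downward Loewenheim-Skolem argument. Every property required of \<open>H\<close> and of its
  topology says that some element of the group or some open set exists, for given parameters: a
  neighbourhood of \<open>g\<close> carried by \<open>\<alpha>\<close> into a given open set, neighbourhoods of \<open>g\<close> and \<open>h\<close> whose
  product lies in \<open>P\<close>, and so on. As the points of \<open>X\<close> and its open sets can be replaced by members
  of \<open>\<B>\<close>, at most \<open>|\<B>|\<close> witnesses suffice for group elements \<open>g, h\<close> and open sets \<open>P, Q\<close> of \<open>G\<close>
  (\<open>ex_small_witnessed\<close>). Closing off under them countably often (\<open>closing_off\<close>) gives a subgroup
  \<open>H\<close> and a family \<open>N\<close> of open sets, both of size at most \<open>|\<B>|\<close>, which contain their own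
  witnesses. The traces of \<open>N\<close> on \<open>H\<close> are then a base of the wanted topology
  (\<open>trace_topology_d_open_action\<close>).

  Two points need more than copying a property from \<open>G\<close>. A function that separates a point
  from a closed set must remain continuous for the coarser topology; since it is real valued, it is
  enough to put into \<open>N\<close> the countably many preimages of a countable base of the line. And
  \<open>d\<close>-openness survives the passage from \<open>G\<close> to \<open>H\<close> although \<open>H\<close> need not be dense in \<open>G\<close>: if
  \<open>p\<close> in \<open>P\<close> moves \<open>x\<close> into \<open>U\<close>, then it moves some basic neighbourhood of \<open>x\<close> into a basic set inside
  \<open>U\<close>, so one element of \<open>P\<close> chosen for each pair of basic sets makes \<open>(P \<inter> H)x\<close> dense in
  \<open>Px\<close> for all \<open>x\<close> simultaneously. Hence the two orbit pieces have the same closure.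

  If \<open>\<B>\<close> is finite, then \<open>X\<close> is discrete, and the trivial group acts \<open>d\<close>-openly.
\<close>

section \<open>Cardinal bounds and closing off\<close>

lemma card_of_countable_ordLeq_infinite:
  assumes "infinite B" and "countable A"
  shows "|A| \<le>o |B|"
proof -
  obtain f :: "_ \<Rightarrow> nat" where "inj_on f A"
    using assms(2) by (auto simp: countable_def)
  then have "|A| \<le>o |UNIV :: nat set|"
    using card_of_ordLeq by blast
  then show ?thesis
    using assms(1) infinite_iff_card_of_nat ordLeq_transitive by blast
qed

lemma card_of_Un_ordLeq_infinite_set:
  assumes "infinite B" and "|A| \<le>o |B|" and "|C| \<le>o |B|"
  shows "|A \<union> C| \<le>o |B|"
proof -
  have "A \<union> C = (\<Union>b\<in>(UNIV :: bool set). if b then A else C)"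
    by (auto split: if_splits)
  moreover have "|\<Union>b\<in>(UNIV :: bool set). if b then A else C| \<le>o |B|"
    using assms by (intro card_of_UNION_ordLeq_infinite card_of_countable_ordLeq_infinite) auto
  ultimately show ?thesis by simp
qed

lemma card_of_Times_ordLeq_infinite_set:
  assumes "infinite B" and "|A| \<le>o |B|" and "|C| \<le>o |B|"
  shows "|A \<times> C| \<le>o |B|"
  using assms by (intro card_of_Sigma_ordLeq_infinite) auto

lemma card_of_image_ordLeq:
  assumes "|A| \<le>o |B|"
  shows "|f ` A| \<le>o |B|"
  using card_of_image assms ordLeq_transitive by blast

text \<open>The closing off underlying the downward Loewenheim-Skolem theorem, for two sorts of objects.
  Countably many stages suffice because a condition has only four parameters: they all occur at some
  stage, and the next stage contains their witnesses.\<close>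

lemma closing_off:
  fixes \<Phi> :: "'b \<Rightarrow> 'b \<Rightarrow> 'c \<Rightarrow> 'c \<Rightarrow> 'b set \<Rightarrow> 'c set \<Rightarrow> bool"
  assumes inf: "infinite B"
    and start: "e \<in> D" "c \<in> \<D>"
    and mono: "\<And>x y p q E W E' W'. \<Phi> x y p q E W \<Longrightarrow> E \<subseteq> E' \<Longrightarrow> W \<subseteq> W' \<Longrightarrow> \<Phi> x y p q E' W'"
    and witness: "\<And>x y p q. x \<in> D \<Longrightarrow> y \<in> D \<Longrightarrow> p \<in> \<D> \<Longrightarrow> q \<in> \<D> \<Longrightarrow>
        \<exists>E W. E \<subseteq> D \<and> W \<subseteq> \<D> \<and> |E| \<le>o |B| \<and> |W| \<le>o |B| \<and> \<Phi> x y p q E W"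
  obtains H N where "H \<subseteq> D" "N \<subseteq> \<D>" "e \<in> H" "c \<in> N" "|H| \<le>o |B|" "|N| \<le>o |B|"
    "\<And>x y p q. x \<in> H \<Longrightarrow> y \<in> H \<Longrightarrow> p \<in> N \<Longrightarrow> q \<in> N \<Longrightarrow> \<Phi> x y p q H N"
proof -
  obtain E W where EW: "\<And>x y p q. x \<in> D \<Longrightarrow> y \<in> D \<Longrightarrow> p \<in> \<D> \<Longrightarrow> q \<in> \<D> \<Longrightarrow>
      E x y p q \<subseteq> D \<and> W x y p q \<subseteq> \<D> \<and> |E x y p q| \<le>o |B| \<and> |W x y p q| \<le>o |B| \<and>
      \<Phi> x y p q (E x y p q) (W x y p q)"
    using witness by metis
  define step where "step S =
      (fst S \<union> (\<Union>(x, y, p, q)\<in>fst S \<times> fst S \<times> snd S \<times> snd S. E x y p q),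
       snd S \<union> (\<Union>(x, y, p, q)\<in>fst S \<times> fst S \<times> snd S \<times> snd S. W x y p q))" for S
  define stage where "stage n = (step ^^ n) ({e}, {c})" for n
  define Hs where "Hs n = fst (stage n)" for n
  define Ns where "Ns n = snd (stage n)" for n
  have Hs_0: "Hs 0 = {e}" and Ns_0: "Ns 0 = {c}"
    by (simp_all add: Hs_def Ns_def stage_def)
  have Hs_Suc: "Hs (Suc n) = Hs n \<union> (\<Union>(x, y, p, q)\<in>Hs n \<times> Hs n \<times> Ns n \<times> Ns n. E x y p q)"
    and Ns_Suc: "Ns (Suc n) = Ns n \<union> (\<Union>(x, y, p, q)\<in>Hs n \<times> Hs n \<times> Ns n \<times> Ns n. W x y p q)" for n
    by (simp_all only: Hs_def Ns_def stage_def funpow.simps comp_apply step_def fst_conv snd_conv)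
  have stage_bound: "Hs n \<subseteq> D \<and> Ns n \<subseteq> \<D> \<and> |Hs n| \<le>o |B| \<and> |Ns n| \<le>o |B|" for n
  proof (induction n)
    case 0
    then show ?case
      using start inf by (auto simp: Hs_0 Ns_0 intro!: card_of_countable_ordLeq_infinite)
  next
    case (Suc n)
    let ?I = "Hs n \<times> Hs n \<times> Ns n \<times> Ns n"
    have sub: "Hs n \<subseteq> D" "Ns n \<subseteq> \<D>"
      using Suc by simp_all
    have EW_sub: "(case i of (x, y, p, q) \<Rightarrow> E x y p q) \<subseteq> D"
      "(case i of (x, y, p, q) \<Rightarrow> W x y p q) \<subseteq> \<D>" if i: "i \<in> ?I" for i
    proof -
      obtain x y p q where "i = (x, y, p, q)"
        by (cases i)
      then show "(case i of (x, y, p, q) \<Rightarrow> E x y p q) \<subseteq> D"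
        "(case i of (x, y, p, q) \<Rightarrow> W x y p q) \<subseteq> \<D>"
        using EW[of x y p q] i sub by auto
    qed
    have I: "|?I| \<le>o |B|"
      using Suc inf by (intro card_of_Times_ordLeq_infinite_set) auto
    have "|\<Union>(x, y, p, q)\<in>?I. E x y p q| \<le>o |B|" "|\<Union>(x, y, p, q)\<in>?I. W x y p q| \<le>o |B|"
      using Suc EW by (intro card_of_UNION_ordLeq_infinite[OF inf I] ballI; clarify;
          meson subsetD)+
    then have "|Hs (Suc n)| \<le>o |B|" "|Ns (Suc n)| \<le>o |B|"
      unfolding Hs_Suc Ns_Suc using Suc inf by (auto intro!: card_of_Un_ordLeq_infinite_set)
    moreover have "Hs (Suc n) \<subseteq> D" "Ns (Suc n) \<subseteq> \<D>"
      unfolding Hs_Suc Ns_Suc by (intro Un_least UN_least sub EW_sub; assumption)+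
    ultimately show ?case by blast
  qed
  have mono_stage: "m \<le> n \<Longrightarrow> Hs m \<subseteq> Hs n \<and> Ns m \<subseteq> Ns n" for m n
    by (induction n rule: dec_induct) (auto simp: Hs_Suc Ns_Suc)
  define H where "H = (\<Union>n. Hs n)"
  define N where "N = (\<Union>n. Ns n)"
  show thesis
  proof
    show "H \<subseteq> D" "N \<subseteq> \<D>"
      using stage_bound by (auto simp: H_def N_def)
    show "e \<in> H" "c \<in> N"
      using Hs_0 Ns_0 by (auto simp: H_def N_def)
    show "|H| \<le>o |B|" "|N| \<le>o |B|"
      unfolding H_def N_def using stage_bound inf
      by (auto intro!: card_of_UNION_ordLeq_infinite[OF inf]
          card_of_countable_ordLeq_infinite[OF inf, of "UNIV :: nat set"])
  next
    fix x y p q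
    assume xy: "x \<in> H" "y \<in> H" and pq: "p \<in> N" "q \<in> N"
    obtain i j k l where ijkl: "x \<in> Hs i" "y \<in> Hs j" "p \<in> Ns k" "q \<in> Ns l"
      using xy pq by (auto simp: H_def N_def)
    define n where "n = max (max i j) (max k l)"
    have le: "i \<le> n" "j \<le> n" "k \<le> n" "l \<le> n"
      by (simp_all add: n_def)
    have "x \<in> Hs n" "y \<in> Hs n" "p \<in> Ns n" "q \<in> Ns n"
      using ijkl mono_stage[OF le(1)] mono_stage[OF le(2)] mono_stage[OF le(3)]
        mono_stage[OF le(4)] by auto
    then have "E x y p q \<subseteq> Hs (Suc n)" "W x y p q \<subseteq> Ns (Suc n)"
      unfolding Hs_Suc Ns_Suc by (intro le_supI2; force)+
    then have "E x y p q \<subseteq> H" "W x y p q \<subseteq> N"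
      by (auto simp: H_def N_def)
    then show "\<Phi> x y p q H N"
      using mono EW stage_bound \<open>x \<in> Hs n\<close> \<open>y \<in> Hs n\<close> \<open>p \<in> Ns n\<close> \<open>q \<in> Ns n\<close> by (meson subsetD)
  qed
qed

section \<open>Continuity in terms of neighbourhoods\<close>

lemma continuous_map_iff_neighbourhoods:
  "continuous_map X Y f \<longleftrightarrow>
    (\<forall>x\<in>topspace X. f x \<in> topspace Y) \<and>
    (\<forall>x\<in>topspace X. \<forall>U. openin Y U \<and> f x \<in> U \<longrightarrow>
       (\<exists>A. openin X A \<and> x \<in> A \<and> (\<forall>a\<in>A. f a \<in> U)))"
  (is "?lhs \<longleftrightarrow> ?rhs")
proof
  assume f: ?lhs
  have "openin X {x \<in> topspace X. f x \<in> U}" if "openin Y U" for U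
    using f that by (auto simp: continuous_map_def)
  then show ?rhs
    using f by (fastforce simp: continuous_map_def)
next
  assume r: ?rhs
  have "openin X {x \<in> topspace X. f x \<in> U}" if "openin Y U" for U
  proof (subst openin_subopen, safe)
    fix x assume "x \<in> topspace X" "f x \<in> U"
    with r that obtain A where "openin X A" "x \<in> A" "\<forall>a\<in>A. f a \<in> U"
      by meson
    then show "\<exists>A. openin X A \<and> x \<in> A \<and> A \<subseteq> {x \<in> topspace X. f x \<in> U}"
      using openin_subset by blast
  qed
  then show ?lhs
    using r by (auto simp: continuous_map_def)
qed

lemma continuous_map_prod_iff_neighbourhoods:
  "continuous_map (prod_topology X Z) Y (\<lambda>(x, z). f x z) \<longleftrightarrow>
    (\<forall>x\<in>topspace X. \<forall>z\<in>topspace Z. f x z \<in> topspace Y) \<and>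
    (\<forall>x\<in>topspace X. \<forall>z\<in>topspace Z. \<forall>U. openin Y U \<and> f x z \<in> U \<longrightarrow>
       (\<exists>A C. openin X A \<and> openin Z C \<and> x \<in> A \<and> z \<in> C \<and> (\<forall>a\<in>A. \<forall>c\<in>C. f a c \<in> U)))"
proof -
  have "(\<exists>A. openin (prod_topology X Z) A \<and> (x, z) \<in> A \<and> (\<forall>a\<in>A. (\<lambda>(x, z). f x z) a \<in> U)) \<longleftrightarrow>
      (\<exists>A C. openin X A \<and> openin Z C \<and> x \<in> A \<and> z \<in> C \<and> (\<forall>a\<in>A. \<forall>c\<in>C. f a c \<in> U))"
    (is "?l \<longleftrightarrow> ?r") for x z U
  proof
    assume ?l
    then obtain A where A: "openin (prod_topology X Z) A" "(x, z) \<in> A"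
      "\<And>a c. (a, c) \<in> A \<Longrightarrow> f a c \<in> U"
      by fastforce
    obtain A' C where "openin X A'" "openin Z C" "x \<in> A'" "z \<in> C" "A' \<times> C \<subseteq> A"
      using A(1)[unfolded openin_prod_topology_alt] A(2) by meson
    then show ?r
      using A(3) by blast
  next
    assume ?r
    then obtain A C where "openin X A" "openin Z C" "x \<in> A" "z \<in> C" "\<forall>a\<in>A. \<forall>c\<in>C. f a c \<in> U"
      by blast
    then show ?l
      by (intro exI[of _ "A \<times> C"]) (auto simp: openin_prod_Times_iff)
  qed
  then show ?thesis
    by (subst continuous_map_iff_neighbourhoods) simp
qed

lemma topology_base_nbhd:
  assumes "topology_base X \<B>" and "openin X U" and "x \<in> U"
  obtains V where "V \<in> \<B>" "openin X V" "x \<in> V" "V \<subseteq> U"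
  using assms unfolding topology_base_def by meson

lemma continuous_map_neighbourhood:
  assumes "continuous_map X Y f" and "x \<in> topspace X" and "openin Y U" and "f x \<in> U"
  obtains A where "openin X A" "x \<in> A" "\<forall>a\<in>A. f a \<in> U"
  using assms(1)[unfolded continuous_map_iff_neighbourhoods] assms(2-4) by meson

lemma continuous_map_prod_neighbourhoods:
  assumes "continuous_map (prod_topology X Z) Y (\<lambda>(x, z). f x z)"
    and "x \<in> topspace X" and "z \<in> topspace Z" and "openin Y U" and "f x z \<in> U"
  obtains A C where "openin X A" "openin Z C" "x \<in> A" "z \<in> C" "\<forall>a\<in>A. \<forall>c\<in>C. f a c \<in> U"
  using assms(1)[unfolded continuous_map_prod_iff_neighbourhoods, THEN conjunct2, rule_format,
      OF assms(2,3) conjI[OF assms(4,5)]] by (elim exE conjE)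

section \<open>Small sets of witnesses\<close>

text \<open>In these conditions \<open>W\<close> is a family of open sets of the group and \<open>E\<close> a set of its elements;
  each says that a property of the group or of the action, at the given parameters, can be seen within
  \<open>W\<close> and \<open>E\<close>. They refer to points and open sets of \<open>X\<close>, and to real functions, without any
  bound on where these come from: only witnesses in the group have to be kept few.\<close>

definition mult_witnessed :: "('g, 'm) monoid_scheme \<Rightarrow> 'g \<Rightarrow> 'g \<Rightarrow> 'g set \<Rightarrow> 'g set set \<Rightarrow> bool" where
  "mult_witnessed G g h P W \<longleftrightarrow> (g \<otimes>\<^bsub>G\<^esub> h \<in> P \<longrightarrow>
     (\<exists>A\<in>W. \<exists>C\<in>W. g \<in> A \<and> h \<in> C \<and> (\<forall>a\<in>A. \<forall>c\<in>C. a \<otimes>\<^bsub>G\<^esub> c \<in> P)))"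

definition inv_witnessed :: "('g, 'm) monoid_scheme \<Rightarrow> 'g \<Rightarrow> 'g set \<Rightarrow> 'g set set \<Rightarrow> bool" where
  "inv_witnessed G g P W \<longleftrightarrow> (inv\<^bsub>G\<^esub> g \<in> P \<longrightarrow> (\<exists>A\<in>W. g \<in> A \<and> (\<forall>a\<in>A. inv\<^bsub>G\<^esub> a \<in> P)))"

definition separation_witnessed :: "'g \<Rightarrow> 'g \<Rightarrow> 'g set set \<Rightarrow> bool" where
  "separation_witnessed g h W \<longleftrightarrow> (g \<noteq> h \<longrightarrow> (\<exists>A\<in>W. \<exists>C\<in>W. g \<in> A \<and> h \<in> C \<and> disjnt A C))"

text \<open>The last clause is continuity of \<open>f\<close> with all neighbourhoods taken from \<open>W\<close>; it makes \<open>f\<close>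
  continuous for every topology that has the members of \<open>W\<close> among its open sets.\<close>

definition function_witnessed :: "('g, 'm) monoid_scheme \<Rightarrow> 'g \<Rightarrow> 'g set \<Rightarrow> 'g set set \<Rightarrow> bool" where
  "function_witnessed G g P W \<longleftrightarrow> (g \<in> P \<longrightarrow>
     (\<exists>f :: 'g \<Rightarrow> real. f g = 0 \<and> f ` (carrier G - P) \<subseteq> {1} \<and>
        (\<forall>x\<in>carrier G. \<forall>U. open U \<and> f x \<in> U \<longrightarrow> (\<exists>A\<in>W. x \<in> A \<and> (\<forall>a\<in>A. f a \<in> U)))))"

definition action_witnessed :: "'a topology \<Rightarrow> ('g \<Rightarrow> 'a \<Rightarrow> 'a) \<Rightarrow> 'g \<Rightarrow> 'g set set \<Rightarrow> bool" where
  "action_witnessed X \<alpha> g W \<longleftrightarrow> (\<forall>x\<in>topspace X. \<forall>U. openin X U \<and> \<alpha> g x \<in> U \<longrightarrow>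
     (\<exists>A\<in>W. \<exists>V. openin X V \<and> g \<in> A \<and> x \<in> V \<and> (\<forall>a\<in>A. \<forall>v\<in>V. \<alpha> a v \<in> U)))"

text \<open>This is density of \<open>(P \<inter> E)x\<close> in \<open>Px\<close> for every \<open>x\<close>, whence both have the same closure: in this
  form \<open>d\<close>-openness passes from a group to a subgroup containing \<open>E\<close>.\<close>

definition orbits_witnessed :: "'a topology \<Rightarrow> ('g \<Rightarrow> 'a \<Rightarrow> 'a) \<Rightarrow> 'g set \<Rightarrow> 'g set \<Rightarrow> bool" where
  "orbits_witnessed X \<alpha> P E \<longleftrightarrow> (\<forall>p\<in>P. \<forall>x\<in>topspace X. \<forall>U. openin X U \<and> \<alpha> p x \<in> U \<longrightarrow>
     (\<exists>q\<in>P \<inter> E. \<alpha> q x \<in> U))"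

definition witnessed ::
  "('g, 'm) monoid_scheme \<Rightarrow> 'a topology \<Rightarrow> ('g \<Rightarrow> 'a \<Rightarrow> 'a) \<Rightarrow>
    'g \<Rightarrow> 'g \<Rightarrow> 'g set \<Rightarrow> 'g set \<Rightarrow> 'g set \<Rightarrow> 'g set set \<Rightarrow> bool" where
  "witnessed G X \<alpha> g h P Q E W \<longleftrightarrow>
     g \<otimes>\<^bsub>G\<^esub> h \<in> E \<and> inv\<^bsub>G\<^esub> g \<in> E \<and> P \<inter> Q \<in> W \<and>
     mult_witnessed G g h P W \<and> inv_witnessed G g P W \<and> separation_witnessed g h W \<and>
     function_witnessed G g P W \<and> action_witnessed X \<alpha> g W \<and> orbits_witnessed X \<alpha> P E"

text \<open>Monotonicity carries witnesses from a stage of the closing off over to its limit.\<close>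

lemma family_witnessed_mono:
  assumes "W \<subseteq> W'"
  shows "mult_witnessed G g h P W \<Longrightarrow> mult_witnessed G g h P W'"
    and "inv_witnessed G g P W \<Longrightarrow> inv_witnessed G g P W'"
    and "separation_witnessed g h W \<Longrightarrow> separation_witnessed g h W'"
    and "function_witnessed G g P W \<Longrightarrow> function_witnessed G g P W'"
    and "action_witnessed X \<alpha> g W \<Longrightarrow> action_witnessed X \<alpha> g W'"
proof -
  have ex_mono: "\<exists>A\<in>W. \<phi> A \<Longrightarrow> \<exists>A\<in>W'. \<phi> A" for \<phi>
    using assms by blast
  show "mult_witnessed G g h P W \<Longrightarrow> mult_witnessed G g h P W'"
    unfolding mult_witnessed_def
    by (erule imp_forward, assumption, elim bexE, intro bexI) (assumption | erule subsetD[OF assms])+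
  show "inv_witnessed G g P W \<Longrightarrow> inv_witnessed G g P W'"
    unfolding inv_witnessed_def
    by (erule imp_forward, assumption, elim bexE, intro bexI) (assumption | erule subsetD[OF assms])+
  show "separation_witnessed g h W \<Longrightarrow> separation_witnessed g h W'"
    unfolding separation_witnessed_def
    by (erule imp_forward, assumption, elim bexE, intro bexI) (assumption | erule subsetD[OF assms])+
  show "function_witnessed G g P W \<Longrightarrow> function_witnessed G g P W'"
    unfolding function_witnessed_def
  proof (erule imp_forward, assumption, elim exE conjE)
    fix f :: "_ \<Rightarrow> real"
    assume f: "f g = 0" "f ` (carrier G - P) \<subseteq> {1}"
      "\<forall>x\<in>carrier G. \<forall>U. open U \<and> f x \<in> U \<longrightarrow> (\<exists>A\<in>W. x \<in> A \<and> (\<forall>a\<in>A. f a \<in> U))"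
    have "\<forall>x\<in>carrier G. \<forall>U. open U \<and> f x \<in> U \<longrightarrow> (\<exists>A\<in>W'. x \<in> A \<and> (\<forall>a\<in>A. f a \<in> U))"
      using f(3) by (intro ballI allI impI ex_mono) simp
    with f show "\<exists>f :: _ \<Rightarrow> real. f g = 0 \<and> f ` (carrier G - P) \<subseteq> {1} \<and>
        (\<forall>x\<in>carrier G. \<forall>U. open U \<and> f x \<in> U \<longrightarrow> (\<exists>A\<in>W'. x \<in> A \<and> (\<forall>a\<in>A. f a \<in> U)))"
      by (intro exI[of _ f] conjI)
  qed
  show "action_witnessed X \<alpha> g W \<Longrightarrow> action_witnessed X \<alpha> g W'"
    unfolding action_witnessed_def by (intro ballI allI impI ex_mono) simp
qed

lemma orbits_witnessed_mono:
  assumes "orbits_witnessed X \<alpha> P E" and "E \<subseteq> E'"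
  shows "orbits_witnessed X \<alpha> P E'"
  unfolding orbits_witnessed_def
proof (intro ballI allI impI)
  fix p x U
  assume "p \<in> P" "x \<in> topspace X" "openin X U \<and> \<alpha> p x \<in> U"
  then obtain q where "q \<in> P \<inter> E" "\<alpha> q x \<in> U"
    using assms(1) unfolding orbits_witnessed_def by meson
  then show "\<exists>q\<in>P \<inter> E'. \<alpha> q x \<in> U"
    using assms(2) by blast
qed

lemma witnessed_mono:
  assumes "witnessed G X \<alpha> g h P Q E W" and "E \<subseteq> E'" and "W \<subseteq> W'"
  shows "witnessed G X \<alpha> g h P Q E' W'"
  using assms family_witnessed_mono[OF assms(3)] orbits_witnessed_mono[OF _ assms(2)]
  unfolding witnessed_def by (metis subsetD)

text \<open>The preimages of a countable base of the real line determine whether a real function is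
  continuous, so a countable family of open sets keeps \<open>f\<close> continuous.\<close>

lemma countable_witness_continuous_real:
  fixes f :: "'g \<Rightarrow> real"
  assumes "continuous_map T euclideanreal f"
  obtains W where "countable W" "W \<subseteq> Collect (openin T)"
    "\<And>x U. x \<in> topspace T \<Longrightarrow> open U \<Longrightarrow> f x \<in> U \<Longrightarrow> \<exists>A\<in>W. x \<in> A \<and> (\<forall>a\<in>A. f a \<in> U)"
proof -
  obtain \<J> :: "real set set" where \<J>: "countable \<J>" "topological_basis \<J>"
    using ex_countable_basis by blast
  define W where "W = (\<lambda>J. {x \<in> topspace T. f x \<in> J}) ` \<J>"
  show thesis
  proof
    show "countable W"
      using \<J> by (simp add: W_def)
    show "W \<subseteq> Collect (openin T)"
      using openin_continuous_map_preimage[OF assms] topological_basis_open[OF \<J>(2)]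
      by (auto simp: W_def)
    show "\<exists>A\<in>W. x \<in> A \<and> (\<forall>a\<in>A. f a \<in> U)" if x: "x \<in> topspace T" and U: "open U" "f x \<in> U" for x U
    proof -
      obtain J where "J \<in> \<J>" "f x \<in> J" "J \<subseteq> U"
        using topological_basisE[OF \<J>(2) U] by blast
      then show ?thesis
        using x by (intro bexI[of _ "{x \<in> topspace T. f x \<in> J}"]) (auto simp: W_def)
    qed
  qed
qed

text \<open>Continuity of the action at all points \<open>(g, x)\<close> with \<open>g\<close> fixed only needs one neighbourhood
  of \<open>g\<close> for each pair of basic sets, however many points \<open>X\<close> has.\<close>

lemma small_witness_action_continuous:
  assumes inf: "infinite \<B>" and base: "topology_base X \<B>"
    and cont: "continuous_map (prod_topology T X) X (\<lambda>(g, x). \<alpha> g x)"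
    and g: "g \<in> topspace T"
  obtains W where "|W| \<le>o |\<B>|" "W \<subseteq> Collect (openin T)" "action_witnessed X \<alpha> g W"
proof -
  define good where "good U V A \<longleftrightarrow> openin T A \<and> g \<in> A \<and> (\<forall>a\<in>A. \<forall>v\<in>V. \<alpha> a v \<in> U)" for U V A
  define I where "I = {(U, V) \<in> \<B> \<times> \<B>. \<exists>A. good U V A}"
  define W where "W = (\<lambda>(U, V). SOME A. good U V A) ` I"
  have good: "good U V (SOME A. good U V A)" if "(U, V) \<in> I" for U V
    using that unfolding I_def by (auto intro: someI)
  show thesis
  proof
    have "|I| \<le>o |\<B> \<times> \<B>|"
      by (intro card_of_mono1) (auto simp: I_def)
    then have "|I| \<le>o |\<B>|"
      using card_of_Times_ordLeq_infinite_set[OF inf, of \<B> \<B>] card_of_refl ordIso_imp_ordLeq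
        ordLeq_transitive by blast
    then show "|W| \<le>o |\<B>|"
      unfolding W_def by (rule card_of_image_ordLeq)
    show "W \<subseteq> Collect (openin T)"
      using good by (auto simp: W_def good_def)
    show "action_witnessed X \<alpha> g W"
      unfolding action_witnessed_def
    proof (intro ballI allI impI; elim conjE)
      fix x U
      assume x: "x \<in> topspace X" and U: "openin X U" "\<alpha> g x \<in> U"
      obtain U' where U': "U' \<in> \<B>" "openin X U'" "\<alpha> g x \<in> U'" "U' \<subseteq> U"
        using topology_base_nbhd[OF base U] .
      then obtain A V where AV: "openin T A" "openin X V" "g \<in> A" "x \<in> V" "\<forall>a\<in>A. \<forall>v\<in>V. \<alpha> a v \<in> U'"
        using continuous_map_prod_neighbourhoods[OF cont g x] U' by metis
      obtain V' where V': "V' \<in> \<B>" "openin X V'" "x \<in> V'" "V' \<subseteq> V"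
        using topology_base_nbhd[OF base] AV(2,4) by metis
      have UV: "(U', V') \<in> I"
        using AV V' U' by (auto simp: I_def good_def)
      show "\<exists>A\<in>W. \<exists>V. openin X V \<and> g \<in> A \<and> x \<in> V \<and> (\<forall>a\<in>A. \<forall>v\<in>V. \<alpha> a v \<in> U)"
        using good[OF UV] V'(2,3) U'(4) UV
        by (intro bexI[of _ "SOME A. good U' V' A"] exI[of _ V']) (auto simp: good_def W_def)
    qed
  qed
qed

text \<open>One element of \<open>P\<close> is chosen for each pair \<open>(U, V)\<close> of basic sets such that \<open>P\<close> has an element
  mapping \<open>V\<close> into \<open>U\<close>. It serves all points of \<open>V\<close> at once; this is why a set of size \<open>|\<B>|\<close>
  suffices for all orbits, although \<open>X\<close> may have more points and \<open>P\<close> no dense subset of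
  that size.\<close>

lemma small_witness_orbits_dense:
  assumes inf: "infinite \<B>" and base: "topology_base X \<B>"
    and cont: "\<And>p. p \<in> P \<Longrightarrow> continuous_map X X (\<alpha> p)"
  obtains E where "|E| \<le>o |\<B>|" "E \<subseteq> P" "orbits_witnessed X \<alpha> P E"
proof -
  define good where "good U V p \<longleftrightarrow> p \<in> P \<and> (\<forall>v\<in>V. \<alpha> p v \<in> U)" for U V p
  define I where "I = {(U, V) \<in> \<B> \<times> \<B>. \<exists>p. good U V p}"
  define E where "E = (\<lambda>(U, V). SOME p. good U V p) ` I"
  have good: "good U V (SOME p. good U V p)" if "(U, V) \<in> I" for U V
    using that unfolding I_def by (auto intro: someI)
  show thesis
  proof
    have "|I| \<le>o |\<B> \<times> \<B>|"
      by (intro card_of_mono1) (auto simp: I_def)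
    then have "|I| \<le>o |\<B>|"
      using card_of_Times_ordLeq_infinite_set[OF inf, of \<B> \<B>] card_of_refl ordIso_imp_ordLeq
        ordLeq_transitive by blast
    then show "|E| \<le>o |\<B>|"
      unfolding E_def by (rule card_of_image_ordLeq)
    show "E \<subseteq> P"
      using good by (auto simp: E_def good_def)
    show "orbits_witnessed X \<alpha> P E"
      unfolding orbits_witnessed_def
    proof (intro ballI allI impI; elim conjE)
      fix p x U
      assume p: "p \<in> P" and x: "x \<in> topspace X" and U: "openin X U" "\<alpha> p x \<in> U"
      obtain U' where U': "U' \<in> \<B>" "openin X U'" "\<alpha> p x \<in> U'" "U' \<subseteq> U"
        using topology_base_nbhd[OF base U] .
      then obtain V where V: "openin X V" "x \<in> V" "\<forall>v\<in>V. \<alpha> p v \<in> U'"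
        using continuous_map_neighbourhood[OF cont[OF p] x] by metis
      obtain V' where V': "V' \<in> \<B>" "openin X V'" "x \<in> V'" "V' \<subseteq> V"
        using topology_base_nbhd[OF base] V(1,2) by metis
      have UV: "(U', V') \<in> I"
        using p V V' U' by (auto simp: I_def good_def)
      then show "\<exists>q\<in>P \<inter> E. \<alpha> q x \<in> U"
        using good[OF UV] V'(3) U'(4)
        by (intro bexI[of _ "SOME p. good U' V' p"]) (auto simp: good_def E_def)
    qed
  qed
qed

text \<open>Only the action contributes families of size \<open>|\<B>|\<close>: the group operations and the separation of
  points need at most two open sets each, and the separating function countably many.\<close>

lemma ex_small_witnessed:
  assumes inf: "infinite \<B>" and base: "topology_base X \<B>"
    and G: "topological_group G T" and act: "continuous_action G T X \<alpha>"
    and g: "g \<in> carrier G" and h: "h \<in> carrier G" and P: "openin T P" and Q: "openin T Q"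
  shows "\<exists>E W. E \<subseteq> carrier G \<and> W \<subseteq> Collect (openin T) \<and> |E| \<le>o |\<B>| \<and> |W| \<le>o |\<B>| \<and>
    witnessed G X \<alpha> g h P Q E W"
proof -
  interpret group G
    using G by (simp add: topological_group_def)
  have top: "topspace T = carrier G"
    and haus: "Hausdorff_space T" and creg: "completely_regular_space T"
    and mult: "continuous_map (prod_topology T T) T (\<lambda>(g, h). g \<otimes>\<^bsub>G\<^esub> h)"
    and inv: "continuous_map T T (\<lambda>g. inv\<^bsub>G\<^esub> g)"
    using G by (auto simp: topological_group_def tychonoff_space_def)
  have \<alpha>: "continuous_map (prod_topology T X) X (\<lambda>(g, x). \<alpha> g x)"
    using act by (simp add: continuous_action_def)
  have P_sub: "P \<subseteq> carrier G"
    using P openin_subset top by blast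
  note small = card_of_countable_ordLeq_infinite[OF inf countable_finite]

  obtain W1 where W1: "finite W1" "W1 \<subseteq> Collect (openin T)" "mult_witnessed G g h P W1"
  proof (cases "g \<otimes>\<^bsub>G\<^esub> h \<in> P")
    case True
    obtain A C where "openin T A" "openin T C" "g \<in> A" "h \<in> C"
      "\<forall>a\<in>A. \<forall>c\<in>C. a \<otimes>\<^bsub>G\<^esub> c \<in> P"
      using continuous_map_prod_neighbourhoods[OF mult _ _ P True] g h top by blast
    then show ?thesis
      by (intro that[of "{A, C}"]) (auto simp: mult_witnessed_def)
  qed (use that[of "{}"] in \<open>auto simp: mult_witnessed_def\<close>)
  obtain W2 where W2: "finite W2" "W2 \<subseteq> Collect (openin T)" "inv_witnessed G g P W2"
  proof (cases "inv\<^bsub>G\<^esub> g \<in> P")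
    case True
    obtain A where "openin T A" "g \<in> A" "\<forall>a\<in>A. inv\<^bsub>G\<^esub> a \<in> P"
      using continuous_map_neighbourhood[OF inv _ P True] g top by blast
    then show ?thesis
      by (intro that[of "{A}"]) (auto simp: inv_witnessed_def)
  qed (use that[of "{}"] in \<open>auto simp: inv_witnessed_def\<close>)
  obtain W3 where W3: "finite W3" "W3 \<subseteq> Collect (openin T)" "separation_witnessed g h W3"
  proof (cases "g = h")
    case False
    then obtain A C where "openin T A" "openin T C" "g \<in> A" "h \<in> C" "disjnt A C"
      using haus[unfolded Hausdorff_space_def, rule_format, of g h] g h top by auto
    then show ?thesis
      by (intro that[of "{A, C}"]) (auto simp: separation_witnessed_def)
  qed (use that[of "{}"] in \<open>auto simp: separation_witnessed_def\<close>)
  obtain W4 where W4: "countable W4" "W4 \<subseteq> Collect (openin T)" "function_witnessed G g P W4"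
  proof (cases "g \<in> P")
    case True
    then obtain f where f: "continuous_map T euclideanreal f" "f g = 0" "f ` (carrier G - P) \<subseteq> {1}"
      using creg P top unfolding completely_regular_space_alt' by metis
    obtain W where W: "countable W" "W \<subseteq> Collect (openin T)"
      "\<And>x U. x \<in> topspace T \<Longrightarrow> open U \<Longrightarrow> f x \<in> U \<Longrightarrow> \<exists>A\<in>W. x \<in> A \<and> (\<forall>a\<in>A. f a \<in> U)"
      using countable_witness_continuous_real[OF f(1)] by blast
    have "function_witnessed G g P W"
      unfolding function_witnessed_def using f(2,3) W(3) top by (intro impI exI[of _ f]) auto
    with W that show ?thesis by blast
  qed (use that[of "{}"] in \<open>auto simp: function_witnessed_def\<close>)
  obtain W5 where W5: "|W5| \<le>o |\<B>|" "W5 \<subseteq> Collect (openin T)" "action_witnessed X \<alpha> g W5"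
    using small_witness_action_continuous[OF inf base \<alpha>, of g] g top by blast
  have \<alpha>_p: "continuous_map X X (\<alpha> p)" if "p \<in> P" for p
  proof -
    have "continuous_map X (prod_topology T X) (\<lambda>x. (p, x))"
      using that P_sub top by (intro continuous_map_pairedI) auto
    from continuous_map_compose[OF this \<alpha>] show ?thesis
      by (simp add: o_def)
  qed
  obtain E where E: "|E| \<le>o |\<B>|" "E \<subseteq> P" "orbits_witnessed X \<alpha> P E"
    by (rule small_witness_orbits_dense[OF inf base, of P \<alpha>]) (use \<alpha>_p in auto)

  define E' where "E' = {g \<otimes>\<^bsub>G\<^esub> h, inv\<^bsub>G\<^esub> g} \<union> E"
  define W where "W = {P \<inter> Q} \<union> W1 \<union> W2 \<union> W3 \<union> W4 \<union> W5"
  have sub: "W1 \<subseteq> W" "W2 \<subseteq> W" "W3 \<subseteq> W" "W4 \<subseteq> W" "W5 \<subseteq> W"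
    by (auto simp: W_def)
  have "E' \<subseteq> carrier G"
    using g h E P_sub by (auto simp: E'_def)
  moreover have "W \<subseteq> Collect (openin T)"
    unfolding W_def using W1 W2 W3 W4 W5 P Q by auto
  moreover have "|E'| \<le>o |\<B>|"
    unfolding E'_def by (intro card_of_Un_ordLeq_infinite_set inf E small) auto
  moreover have "|W| \<le>o |\<B>|"
    unfolding W_def
    by (intro card_of_Un_ordLeq_infinite_set inf small[OF W1(1)] small[OF W2(1)]
        small[OF W3(1)] card_of_countable_ordLeq_infinite[OF inf W4(1)] W5(1) small) simp
  moreover have "witnessed G X \<alpha> g h P Q E' W"
    unfolding witnessed_def
  proof (intro conjI)
    show "g \<otimes>\<^bsub>G\<^esub> h \<in> E'" "inv\<^bsub>G\<^esub> g \<in> E'" "P \<inter> Q \<in> W"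
      by (auto simp: E'_def W_def)
    show "mult_witnessed G g h P W" "inv_witnessed G g P W" "separation_witnessed g h W"
      "function_witnessed G g P W" "action_witnessed X \<alpha> g W"
      using family_witnessed_mono(1)[OF sub(1) W1(3)] family_witnessed_mono(2)[OF sub(2) W2(3)]
        family_witnessed_mono(3)[OF sub(3) W3(3)] family_witnessed_mono(4)[OF sub(4) W4(3)]
        family_witnessed_mono(5)[OF sub(5) W5(3)] by simp_all
    show "orbits_witnessed X \<alpha> P E'"
      using E(3) by (rule orbits_witnessed_mono) (auto simp: E'_def)
  qed
  ultimately show ?thesis by blast
qed

section \<open>The coarse topology on the small group\<close>

text \<open>The group with the coarse topology has to live in another type than \<open>G\<close>, so the open sets in \<open>N\<close>
  are pulled back along an injection \<open>d\<close> instead of being intersected with a subset.\<close>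

definition trace_topology :: "'k set \<Rightarrow> ('k \<Rightarrow> 'g) \<Rightarrow> 'g set set \<Rightarrow> 'k topology" where
  "trace_topology K d N =
    topology (\<lambda>U. U \<subseteq> K \<and> (\<forall>k\<in>U. \<exists>P\<in>N. d k \<in> P \<and> K \<inter> d -` P \<subseteq> U))"

lemma openin_trace_topology:
  assumes "\<And>P Q. P \<in> N \<Longrightarrow> Q \<in> N \<Longrightarrow> P \<inter> Q \<in> N"
  shows "openin (trace_topology K d N) U \<longleftrightarrow>
    U \<subseteq> K \<and> (\<forall>k\<in>U. \<exists>P\<in>N. d k \<in> P \<and> K \<inter> d -` P \<subseteq> U)"
proof -
  have "istopology (\<lambda>U. U \<subseteq> K \<and> (\<forall>k\<in>U. \<exists>P\<in>N. d k \<in> P \<and> K \<inter> d -` P \<subseteq> U))"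
    unfolding istopology_def
  proof (intro conjI allI impI; (elim conjE)?)
    fix U V
    assume U: "\<forall>k\<in>U. \<exists>P\<in>N. d k \<in> P \<and> K \<inter> d -` P \<subseteq> U"
      and V: "\<forall>k\<in>V. \<exists>P\<in>N. d k \<in> P \<and> K \<inter> d -` P \<subseteq> V"
    show "\<forall>k\<in>U \<inter> V. \<exists>P\<in>N. d k \<in> P \<and> K \<inter> d -` P \<subseteq> U \<inter> V"
    proof
      fix k assume "k \<in> U \<inter> V"
      then obtain P Q where "P \<in> N" "d k \<in> P" "K \<inter> d -` P \<subseteq> U" "Q \<in> N" "d k \<in> Q" "K \<inter> d -` Q \<subseteq> V"
        using U V by (meson IntD1 IntD2)
      then show "\<exists>P\<in>N. d k \<in> P \<and> K \<inter> d -` P \<subseteq> U \<inter> V"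
        using assms by (intro bexI[of _ "P \<inter> Q"]) auto
    qed
  next
    fix \<K>
    assume *: "\<forall>U\<in>\<K>. U \<subseteq> K \<and> (\<forall>k\<in>U. \<exists>P\<in>N. d k \<in> P \<and> K \<inter> d -` P \<subseteq> U)"
    then show "\<Union>\<K> \<subseteq> K" by blast
    show "\<forall>k\<in>\<Union>\<K>. \<exists>P\<in>N. d k \<in> P \<and> K \<inter> d -` P \<subseteq> \<Union>\<K>"
      using * by (meson UnionE Union_upper subset_trans)
  qed auto
  then show ?thesis
    by (simp add: trace_topology_def)
qed

text \<open>Each witness condition, read for the image of \<open>d\<close> and the family \<open>N\<close> themselves, becomes the
  corresponding property of the topology pulled back from \<open>N\<close>. For \<open>d\<close>-openness, a neighbourhood of
  the unit contains the trace of some \<open>P\<close> in \<open>N\<close>, and \<open>P\<close> is a neighbourhood of the unit in \<open>G\<close>, where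
  \<open>d\<close>-openness is known; the orbit piece of the trace is dense in that of \<open>P\<close>.\<close>

lemma trace_topology_d_open_action:
  assumes G: "topological_group G T" and act: "continuous_action G T X \<alpha>"
    and dop: "d_open_action G T X \<alpha>"
    and K: "group K" and hom: "d \<in> hom K G" and inj: "inj_on d (carrier K)"
    and N: "N \<subseteq> Collect (openin T)" "carrier G \<in> N"
    and wit: "\<And>k l P Q. k \<in> carrier K \<Longrightarrow> l \<in> carrier K \<Longrightarrow> P \<in> N \<Longrightarrow> Q \<in> N \<Longrightarrow>
      witnessed G X \<alpha> (d k) (d l) P Q (d ` carrier K) N"
  defines "S \<equiv> trace_topology (carrier K) d N"
  shows "topological_group K S" and "continuous_action K S X (\<alpha> \<circ> d)"
    and "d_open_action K S X (\<alpha> \<circ> d)"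
    and "topology_base S ((\<lambda>P. carrier K \<inter> d -` P) ` N)"
proof -
  interpret G: group G
    using G by (simp add: topological_group_def)
  interpret K: group K by (rule K)
  interpret d: group_hom K G d
    using hom by unfold_locales
  have d_mem: "d k \<in> carrier G" if "k \<in> carrier K" for k
    using that by (rule d.hom_closed)
  note w = wit[unfolded witnessed_def]
  have Int: "P \<inter> Q \<in> N" if "P \<in> N" "Q \<in> N" for P Q
    using w[OF K.one_closed K.one_closed that] by simp
  have openin_S: "openin S U \<longleftrightarrow>
      U \<subseteq> carrier K \<and> (\<forall>k\<in>U. \<exists>P\<in>N. d k \<in> P \<and> carrier K \<inter> d -` P \<subseteq> U)" for U
    unfolding S_def using Int by (rule openin_trace_topology)
  have base_open: "openin S (carrier K \<inter> d -` P)" if "P \<in> N" for P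
    unfolding openin_S using that by blast
  have "openin S (carrier K)"
    unfolding openin_S using N(2) d_mem by blast
  then have top: "topspace S = carrier K"
    using openin_S openin_subset by (metis openin_topspace subset_antisym)
  have nbhd: "\<exists>P\<in>N. d k \<in> P \<and> carrier K \<inter> d -` P \<subseteq> U" if "openin S U" "k \<in> U" for k U
    using that unfolding openin_S by blast

  show "topology_base S ((\<lambda>P. carrier K \<inter> d -` P) ` N)"
    unfolding topology_base_def
  proof (intro conjI allI impI ballI; (elim conjE)?)
    show "openin S V" if "V \<in> (\<lambda>P. carrier K \<inter> d -` P) ` N" for V
      using that base_open by blast
    fix U k assume "openin S U" "k \<in> U"
    then show "\<exists>V\<in>(\<lambda>P. carrier K \<inter> d -` P) ` N. k \<in> V \<and> V \<subseteq> U"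
      using nbhd openin_subset top by fastforce
  qed

  have mult: "continuous_map (prod_topology S S) S (\<lambda>(k, l). k \<otimes>\<^bsub>K\<^esub> l)"
    unfolding continuous_map_prod_iff_neighbourhoods top
  proof (intro conjI ballI allI impI; (elim conjE)?)
    fix k l U
    assume kl: "k \<in> carrier K" "l \<in> carrier K" and U: "openin S U" "k \<otimes>\<^bsub>K\<^esub> l \<in> U"
    obtain P where P: "P \<in> N" "d (k \<otimes>\<^bsub>K\<^esub> l) \<in> P" "carrier K \<inter> d -` P \<subseteq> U"
      using nbhd[OF U] by blast
    then have "d k \<otimes>\<^bsub>G\<^esub> d l \<in> P"
      using kl by simp
    then obtain A C where AC: "A \<in> N" "C \<in> N" "d k \<in> A" "d l \<in> C" "\<forall>a\<in>A. \<forall>c\<in>C. a \<otimes>\<^bsub>G\<^esub> c \<in> P"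
      using w[OF kl P(1) P(1)] unfolding mult_witnessed_def by blast
    show "\<exists>A C. openin S A \<and> openin S C \<and> k \<in> A \<and> l \<in> C \<and> (\<forall>a\<in>A. \<forall>c\<in>C. a \<otimes>\<^bsub>K\<^esub> c \<in> U)"
    proof (intro exI conjI ballI)
      show "openin S (carrier K \<inter> d -` A)" "openin S (carrier K \<inter> d -` C)"
        using AC(1,2) base_open by simp_all
      show "k \<in> carrier K \<inter> d -` A" "l \<in> carrier K \<inter> d -` C"
        using AC(3,4) kl by simp_all
      show "a \<otimes>\<^bsub>K\<^esub> c \<in> U" if "a \<in> carrier K \<inter> d -` A" "c \<in> carrier K \<inter> d -` C" for a c
        using that AC(5) by (intro subsetD[OF P(3)]) simp
    qed
  qed auto
  have inv: "continuous_map S S (\<lambda>k. inv\<^bsub>K\<^esub> k)"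
    unfolding continuous_map_iff_neighbourhoods top
  proof (intro conjI ballI allI impI; (elim conjE)?)
    fix k U
    assume k: "k \<in> carrier K" and U: "openin S U" "inv\<^bsub>K\<^esub> k \<in> U"
    obtain P where P: "P \<in> N" "d (inv\<^bsub>K\<^esub> k) \<in> P" "carrier K \<inter> d -` P \<subseteq> U"
      using nbhd[OF U] by blast
    then have "inv\<^bsub>G\<^esub> d k \<in> P"
      using k by simp
    then obtain A where A: "A \<in> N" "d k \<in> A" "\<forall>a\<in>A. inv\<^bsub>G\<^esub> a \<in> P"
      using w[OF k k P(1) P(1)] unfolding inv_witnessed_def by blast
    show "\<exists>A. openin S A \<and> k \<in> A \<and> (\<forall>a\<in>A. inv\<^bsub>K\<^esub> a \<in> U)"
      using A k by (intro exI[of _ "carrier K \<inter> d -` A"])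
        (auto intro!: base_open subsetD[OF P(3)])
  qed auto
  have haus: "Hausdorff_space S"
    unfolding Hausdorff_space_def top
  proof (intro allI impI; elim conjE)
    fix k l
    assume kl: "k \<in> carrier K" "l \<in> carrier K" "k \<noteq> l"
    then have "d k \<noteq> d l"
      using inj by (auto dest: inj_onD)
    then obtain A C where AC: "A \<in> N" "C \<in> N" "d k \<in> A" "d l \<in> C" "disjnt A C"
      using w[OF kl(1,2) N(2) N(2)] unfolding separation_witnessed_def by blast
    show "\<exists>U V. openin S U \<and> openin S V \<and> k \<in> U \<and> l \<in> V \<and> disjnt U V"
    proof (intro exI conjI)
      show "openin S (carrier K \<inter> d -` A)" "openin S (carrier K \<inter> d -` C)"
        using AC(1,2) base_open by simp_all
      show "k \<in> carrier K \<inter> d -` A" "l \<in> carrier K \<inter> d -` C"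
        using AC(3,4) kl by simp_all
      show "disjnt (carrier K \<inter> d -` A) (carrier K \<inter> d -` C)"
        using AC(5) by (auto simp: disjnt_iff)
    qed
  qed
  have creg: "completely_regular_space S"
    unfolding completely_regular_space_alt' top
  proof (intro allI impI)
    fix U k
    assume U: "openin S U" "k \<in> U"
    then have k: "k \<in> carrier K"
      using openin_subset top by blast
    obtain P where P: "P \<in> N" "d k \<in> P" "carrier K \<inter> d -` P \<subseteq> U"
      using nbhd[OF U] by blast
    then obtain f :: "_ \<Rightarrow> real" where f: "f (d k) = 0" "f ` (carrier G - P) \<subseteq> {1}"
      and f_cont: "\<forall>x\<in>carrier G. \<forall>V. open V \<and> f x \<in> V \<longrightarrow> (\<exists>A\<in>N. x \<in> A \<and> (\<forall>a\<in>A. f a \<in> V))"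
      using w[OF k k P(1) P(1)] unfolding function_witnessed_def by blast
    have "continuous_map S euclideanreal (f \<circ> d)"
      unfolding continuous_map_iff_neighbourhoods top
    proof (intro conjI ballI allI impI; (elim conjE)?)
      fix l V
      assume l: "l \<in> carrier K" and V: "openin euclideanreal V" "(f \<circ> d) l \<in> V"
      then obtain A where A: "A \<in> N" "d l \<in> A" "\<forall>a\<in>A. f a \<in> V"
        using f_cont d_mem by (metis comp_apply open_openin)
      then show "\<exists>A. openin S A \<and> l \<in> A \<and> (\<forall>a\<in>A. (f \<circ> d) a \<in> V)"
        using l base_open by (intro exI[of _ "carrier K \<inter> d -` A"]) auto
    qed auto
    moreover have "(f \<circ> d) ` (carrier K - U) \<subseteq> {1}"
    proof clarify
      fix l assume "l \<in> carrier K" "l \<notin> U"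
      then have "d l \<in> carrier G - P"
        using P(3) d_mem by auto
      then have "f (d l) \<in> {1}"
        using f(2) by (rule set_mp[OF _ imageI, rotated])
      then show "(f \<circ> d) l = 1"
        by simp
    qed
    ultimately show "\<exists>f. continuous_map S euclideanreal f \<and> f k = 0 \<and> f ` (carrier K - U) \<subseteq> {1}"
      using f(1) by (intro exI[of _ "f \<circ> d"]) auto
  qed
  show "topological_group K S"
    using K top haus creg mult inv by (simp add: topological_group_def tychonoff_space_def)

  have "group_hom G (BijGroup (topspace X)) \<alpha>"
    using act by (simp add: continuous_action_def group_action_def)
  then have "\<alpha> \<in> hom G (BijGroup (topspace X))"
    by (simp add: group_hom_def group_hom_axioms_def)
  with hom have "\<alpha> \<circ> d \<in> hom K (BijGroup (topspace X))"
    by (rule Group.hom_compose)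
  then have "group_action K (topspace X) (\<alpha> \<circ> d)"
    using K group_BijGroup
    by (simp add: group_action_def group_hom_def group_hom_axioms_def)
  moreover have "continuous_map (prod_topology S X) X (\<lambda>(k, x). (\<alpha> \<circ> d) k x)"
    unfolding continuous_map_prod_iff_neighbourhoods top
  proof (intro conjI ballI allI impI; (elim conjE)?)
    fix k x
    assume kx: "k \<in> carrier K" "x \<in> topspace X"
    have "topspace T = carrier G"
      using G by (simp add: topological_group_def)
    then show "(\<alpha> \<circ> d) k x \<in> topspace X"
      using act kx d_mem
      by (auto simp: continuous_action_def continuous_map_prod_iff_neighbourhoods)
    fix U
    assume "openin X U" "(\<alpha> \<circ> d) k x \<in> U"
    then obtain A V where AV: "A \<in> N" "openin X V" "d k \<in> A" "x \<in> V" "\<forall>a\<in>A. \<forall>v\<in>V. \<alpha> a v \<in> U"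
      using w[OF kx(1) kx(1) N(2) N(2)] kx(2) unfolding comp_apply action_witnessed_def by meson
    then show "\<exists>A V. openin S A \<and> openin X V \<and> k \<in> A \<and> x \<in> V \<and> (\<forall>a\<in>A. \<forall>v\<in>V. (\<alpha> \<circ> d) a v \<in> U)"
      using kx base_open by (intro exI[of _ "carrier K \<inter> d -` A"] exI[of _ V]) auto
  qed
  ultimately show "continuous_action K S X (\<alpha> \<circ> d)"
    by (simp add: continuous_action_def)

  show "d_open_action K S X (\<alpha> \<circ> d)"
    unfolding d_open_action_def
  proof (intro ballI allI impI; elim conjE)
    fix x V
    assume x: "x \<in> topspace X" and V: "openin S V" "\<one>\<^bsub>K\<^esub> \<in> V"
    obtain P where P: "P \<in> N" "d \<one>\<^bsub>K\<^esub> \<in> P" "carrier K \<inter> d -` P \<subseteq> V"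
      using nbhd[OF V] by blast
    have "openin T P" "\<one>\<^bsub>G\<^esub> \<in> P"
      using N P d.hom_one by auto
    then have "x \<in> X interior_of (X closure_of ((\<lambda>g. \<alpha> g x) ` P))"
      using dop x by (simp add: d_open_action_def)
    moreover have "(\<lambda>g. \<alpha> g x) ` P \<inter> topspace X \<subseteq> X closure_of ((\<lambda>k. (\<alpha> \<circ> d) k x) ` V)"
    proof clarify
      fix p assume p: "p \<in> P" "\<alpha> p x \<in> topspace X"
      show "\<alpha> p x \<in> X closure_of ((\<lambda>k. (\<alpha> \<circ> d) k x) ` V)"
        unfolding in_closure_of
      proof (intro conjI allI impI; (elim conjE)?)
        fix U assume "\<alpha> p x \<in> U" "openin X U"
        then obtain q where "q \<in> P \<inter> d ` carrier K" "\<alpha> q x \<in> U"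
          using w[OF K.one_closed K.one_closed P(1) P(1)] p(1) x
          unfolding orbits_witnessed_def by meson
        then show "\<exists>y. y \<in> (\<lambda>k. (\<alpha> \<circ> d) k x) ` V \<and> y \<in> U"
          using P(3) by auto
      qed (rule p)
    qed
    then have "X closure_of ((\<lambda>g. \<alpha> g x) ` P) \<subseteq> X closure_of ((\<lambda>k. (\<alpha> \<circ> d) k x) ` V)"
      by (metis closure_of_minimal closedin_closure_of closure_of_restrict Int_commute)
    ultimately show "x \<in> X interior_of (X closure_of ((\<lambda>k. (\<alpha> \<circ> d) k x) ` V))"
      using interior_of_mono by blast
  qed
qed

lemma ex_group_copy:
  assumes "group G" and sub: "subgroup H G" and card: "|H| \<le>o |B|"
  obtains K :: "'b monoid" and d where "group K" "d \<in> hom K G" "inj_on d (carrier K)"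
    "d ` carrier K = H" "carrier K \<subseteq> B"
proof -
  interpret group G by fact
  obtain e where e: "inj_on e H" "e ` H \<subseteq> B"
    using card card_of_ordLeq[of H B] by auto
  define d where "d = inv_into H e"
  define K where "K = \<lparr>carrier = e ` H, mult = (\<lambda>x y. e (d x \<otimes>\<^bsub>G\<^esub> d y)), one = e \<one>\<^bsub>G\<^esub>\<rparr>"
  have d_e: "d (e x) = x" if "x \<in> H" for x
    using e(1) that by (simp add: d_def)
  have H: "H \<subseteq> carrier G" "\<And>x y. x \<in> H \<Longrightarrow> y \<in> H \<Longrightarrow> x \<otimes>\<^bsub>G\<^esub> y \<in> H" "\<one>\<^bsub>G\<^esub> \<in> H"
    "\<And>x. x \<in> H \<Longrightarrow> inv\<^bsub>G\<^esub> x \<in> H"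
    using sub by (auto simp: subgroup_def)
  have Hc: "x \<in> H \<Longrightarrow> x \<in> carrier G" for x
    using H(1) by blast
  show thesis
  proof
    show "group K"
    proof (rule groupI)
      show "\<exists>y\<in>carrier K. y \<otimes>\<^bsub>K\<^esub> x = \<one>\<^bsub>K\<^esub>" if "x \<in> carrier K" for x
        using that H by (auto simp: K_def d_e Hc intro!: bexI[of _ "inv\<^bsub>G\<^esub> (d x)"])
    qed (auto simp: K_def d_e H Hc m_assoc)
    show "d \<in> hom K G"
      using H by (auto simp: hom_def K_def d_e)
    show "inj_on d (carrier K)"
      by (auto simp: K_def inj_on_def d_e)
    show "d ` carrier K = H"
      by (auto simp: K_def image_image d_e)
    show "carrier K \<subseteq> B"
      using e(2) by (simp add: K_def)
  qed
qed

section \<open>Spaces of finite weight\<close>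

text \<open>The intersection of the basic neighbourhoods of a point is open when there are finitely many.\<close>

lemma finite_base_Hausdorff_discrete:
  assumes "finite \<B>" and "topology_base X \<B>" and "Hausdorff_space X" and "x \<in> topspace X"
  shows "openin X {x}"
proof -
  let ?M = "topspace X \<inter> \<Inter>{V \<in> \<B>. x \<in> V}"
  have "openin X ?M"
    using assms(1,2) by (intro openin_Int_Inter) (auto simp: topology_base_def)
  moreover have "?M = {x}"
  proof -
    have "y = x" if y: "y \<in> ?M" for y
    proof (rule ccontr)
      assume "y \<noteq> x"
      then obtain U V where "openin X U" "openin X V" "x \<in> U" "y \<in> V" "disjnt U V"
        using assms(3,4) y unfolding Hausdorff_space_def by (metis IntD1)
      then have "openin X U" "x \<in> U" "y \<notin> U"
        by (auto simp: disjnt_iff)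
      then obtain V where "V \<in> \<B>" "x \<in> V" "y \<notin> V"
        using topology_base_nbhd[OF assms(2)] by (metis subsetD)
      then show False
        using y by blast
    qed
    then show ?thesis
      using assms(4) by blast
  qed
  ultimately show ?thesis by simp
qed

text \<open>Where points are open, \<open>d\<close>-openness asks nothing of the group: the closure of an orbit piece
  through \<open>x\<close> contains the open set \<open>{x}\<close>.\<close>

lemma trivial_group_d_open_action:
  fixes c :: 'k and X :: "'a topology"
  assumes discrete: "\<And>x. x \<in> topspace X \<Longrightarrow> openin X {x}"
  defines "H \<equiv> \<lparr>carrier = {c}, mult = (\<lambda>_ _. c), one = c\<rparr>"
  defines "\<gamma> \<equiv> \<lambda>_. \<lambda>x\<in>topspace X. x"
  shows "topological_group H (discrete_topology {c})"
    and "continuous_action H (discrete_topology {c}) X \<gamma>"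
    and "d_open_action H (discrete_topology {c}) X \<gamma>"
proof -
  have H: "group H"
    by (rule groupI) (auto simp: H_def)
  interpret H: group H by (rule H)
  have inv: "inv\<^bsub>H\<^esub> c = c"
    using H.inv_closed[of c] by (simp add: H_def)
  have prod: "prod_topology (discrete_topology {c}) (discrete_topology {c}) =
      discrete_topology ({c} \<times> {c})"
    by (rule prod_topology_discrete_topology[symmetric])
  show "topological_group H (discrete_topology {c})"
    unfolding topological_group_def tychonoff_space_def
    using H by (auto simp: H_def prod inv[unfolded H_def] completely_regular_space_discrete_topology)
  have "\<gamma> \<in> hom H (BijGroup (topspace X))"
    by (auto simp: hom_def H_def BijGroup_def \<gamma>_def id_Bij compose_def)
  then have "group_action H (topspace X) \<gamma>"
    using H group_BijGroup by (simp add: group_action_def group_hom_def group_hom_axioms_def)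
  moreover have "continuous_map (prod_topology (discrete_topology {c}) X) X (\<lambda>(k, x). \<gamma> k x)"
    unfolding continuous_map_prod_iff_neighbourhoods
  proof (intro conjI ballI allI impI; (elim conjE)?)
    fix k x U
    assume "k \<in> topspace (discrete_topology {c})" "x \<in> topspace X" "openin X U" "\<gamma> k x \<in> U"
    then show "\<exists>A C. openin (discrete_topology {c}) A \<and> openin X C \<and> k \<in> A \<and> x \<in> C \<and>
        (\<forall>a\<in>A. \<forall>c\<in>C. \<gamma> a c \<in> U)"
      by (intro exI[of _ "{c}"] exI[of _ "{x}"]) (auto simp: \<gamma>_def discrete)
  qed (auto simp: \<gamma>_def)
  ultimately show "continuous_action H (discrete_topology {c}) X \<gamma>"
    by (simp add: continuous_action_def)
  show "d_open_action H (discrete_topology {c}) X \<gamma>"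
    unfolding d_open_action_def
  proof (intro ballI allI impI; elim conjE)
    fix x V
    assume x: "x \<in> topspace X" and "\<one>\<^bsub>H\<^esub> \<in> V"
    then have "x \<in> (\<lambda>g. \<gamma> g x) ` V"
      by (auto simp: \<gamma>_def)
    then have "x \<in> X closure_of ((\<lambda>g. \<gamma> g x) ` V)"
      unfolding in_closure_of using x by blast
    then have "{x} \<subseteq> X closure_of ((\<lambda>g. \<gamma> g x) ` V)"
      by blast
    then show "x \<in> X interior_of (X closure_of ((\<lambda>g. \<gamma> g x) ` V))"
      using interior_of_maximal[OF _ discrete[OF x]] by blast
  qed
qed

section \<open>Reducing the group of a d-open action\<close>

lemma weight_ordLeq_base:
  assumes "topology_base X \<C>"
  shows "weight X \<le>o |\<C>|"
  using weight_attained[of X] assms by auto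

theorem theorem5p6:
  fixes G :: "'g monoid" and T :: "'g topology"
    and X :: "'a topology" and \<alpha> :: "'g \<Rightarrow> 'a \<Rightarrow> 'a"
  assumes "topological_group G T"
    and "tychonoff_space X"
    and "topspace X \<noteq> {}"
    and "continuous_action G T X \<alpha>"
    and "d_open_action G T X \<alpha>"
  shows "\<exists>(H :: 'a set monoid) (S :: 'a set topology) (\<gamma> :: 'a set \<Rightarrow> 'a \<Rightarrow> 'a).
           topological_group H S \<and>
           continuous_action H S X \<gamma> \<and>
           d_open_action H S X \<gamma> \<and>
           |carrier H| \<le>o weight X \<and>
           weight S \<le>o weight X"
proof -
  obtain \<B> where base: "topology_base X \<B>" and weight: "weight X = |\<B>|"
    using weight_attained[of X] by blast
  show ?thesis
  proof (cases "finite \<B>")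
    case True
    have "\<B> \<noteq> {}"
      using base assms(3) by (force simp: topology_base_def)
    then have one: "|{c}| \<le>o |\<B>|" for c :: 'c
      by (simp add: card_of_singl_ordLeq)
    have discrete: "openin X {x}" if "x \<in> topspace X" for x
      using finite_base_Hausdorff_discrete[OF True base _ that] assms(2)
      by (simp add: tychonoff_space_def)
    let ?S = "discrete_topology {{}} :: 'a set topology"
    have "topology_base ?S {{{}}}"
      by (auto simp: topology_base_def)
    then have "weight ?S \<le>o weight X"
      unfolding weight using weight_ordLeq_base one[of "{{}}"] ordLeq_transitive by metis
    then show ?thesis
      using trivial_group_d_open_action[OF discrete, of "{}"] one[of "{}"] weight
      by (intro exI[of _ "\<lparr>carrier = {{}}, mult = (\<lambda>_ _. {}), one = {}\<rparr>"] exI[of _ ?S]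
          exI[of _ "\<lambda>_. \<lambda>x\<in>topspace X. x"]) simp
  next
    case inf: False
    have G: "group G" and top: "topspace T = carrier G"
      using assms(1) by (auto simp: topological_group_def)
    interpret group G by (rule G)
    have "carrier G \<in> Collect (openin T)"
      using top by (metis mem_Collect_eq openin_topspace)
    then obtain H N where H: "H \<subseteq> carrier G" "\<one>\<^bsub>G\<^esub> \<in> H" "|H| \<le>o |\<B>|"
      and N: "N \<subseteq> Collect (openin T)" "carrier G \<in> N" "|N| \<le>o |\<B>|"
      and wit: "\<And>g h P Q. g \<in> H \<Longrightarrow> h \<in> H \<Longrightarrow> P \<in> N \<Longrightarrow> Q \<in> N \<Longrightarrow> witnessed G X \<alpha> g h P Q H N"
      using closing_off[OF inf one_closed, of "carrier G" "Collect (openin T)" "witnessed G X \<alpha>"]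
        witnessed_mono ex_small_witnessed[OF inf base assms(1,4)]
      by (smt (verit) mem_Collect_eq)
    have "subgroup H G"
      using H wit[OF _ _ N(2) N(2)] by (intro subgroupI) (auto simp: witnessed_def)
    then obtain K :: "'a set monoid" and d where K: "group K" "d \<in> hom K G" "inj_on d (carrier K)"
      "d ` carrier K = H" "carrier K \<subseteq> \<B>"
      using ex_group_copy[OF G _ H(3)] by metis
    let ?S = "trace_topology (carrier K) d N"
    have wit_K: "witnessed G X \<alpha> (d k) (d l) P Q (d ` carrier K) N"
      if "k \<in> carrier K" "l \<in> carrier K" "P \<in> N" "Q \<in> N" for k l P Q
      using that wit K(4) by blast
    note small = trace_topology_d_open_action[OF assms(1,4,5) K(1-3) N(1,2) wit_K]
    have "weight ?S \<le>o |\<B>|"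
      using weight_ordLeq_base[OF small(4)] card_of_image_ordLeq[OF N(3)] ordLeq_transitive by blast
    moreover have "|carrier K| \<le>o |\<B>|"
      using K(5) by (rule card_of_mono1)
    ultimately show ?thesis
      using small(1-3) weight by (intro exI[of _ K] exI[of _ ?S] exI[of _ "\<alpha> \<circ> d"]) simp
  qed
qed

end
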